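(* Any $n+1$ vectors in $\overline{\mathcal R}^{\,n}$ are linearly dependent.
   Context: Let $\mathbb F$ be an algebraically closed field. The ELT algebra $\mathcal R=\mathscr R(\mathbb F,\mathbb R)$ is the set of symbols ${}^{[\ell]}a$ with $a\in\mathbb R$ (tangible value) and $\ell\in\mathbb F$ (layer), with multiplication ${}^{[\ell_1]}a_1\cdot{}^{[\ell_2]}a_2={}^{[\ell_1\ell_2]}(a_1+a_2)$ and addition ${}^{[\ell_1]}a_1+{}^{[\ell_2]}a_2$ equal to ${}^{[\ell_1]}a_1$ if $a_1>a_2$, to ${}^{[\ell_2]}a_2$ if $a_1<a_2$, and to ${}^{[\ell_1+\ell_2]}a_1$ if $a_1=a_2$. Put $\overline{\mathcal R}=\mathcal R\cup\{-\infty\}$, where $-\infty$ is a formal element with $-\infty+\alpha=\alpha+(-\infty)=\alpha$ and $-\infty\cdot\alpha=\alpha\cdot(-\infty)=-\infty$ for all $\alpha$. The layer map is $s({}^{[\ell]}a)=\ell$, $s(-\infty)=0$; on vectors $s$ is applied entrywise. Let $\mathcal R^\times=\{{}^{[\ell]}a\in\mathcal R:\ell\ne0\}$. A family of vectors in $\overline{\mathcal R}^{\,n}$ is linearly dependent if there are finitely many members $v_1,\dots,v_m$ ($m\ge1$, distinct indices) of the family and $a_1,\dots,a_m\in\mathcal R^\times$ with $s\big(\sum_{i=1}^m a_iv_i\big)=(0,\dots,0)$. *)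

theory Defs
  imports "HOL-Analysis.Analysis" "HOL-Computational_Algebra.Computational_Algebra"
begin

text \<open>
  The type \<open>'f elt\<close> is the ELT algebra over \<open>'f\<close> with value group the reals, extended by
  \<open>-\<infinity>\<close>. The element with layer \<open>l\<close> and tangible value \<open>a\<close> is \<open>Elt l a\<close>.
\<close>

datatype 'f elt = NegInf | Elt 'f real

text \<open>
  In the instance below, the class constant \<open>0\<close> is \<open>-\<infinity>\<close>, the neutral element of addition.
  It is not \<open>Elt 0 a\<close>, an element of layer zero.
\<close>

instantiation elt :: (comm_semiring_1) comm_semiring_1
begin

definition zero_elt :: "'a elt" where
  "zero_elt = NegInf"

definition one_elt :: "'a elt" where
  "one_elt = Elt 1 0"

fun plus_elt :: "'a elt \<Rightarrow> 'a elt \<Rightarrow> 'a elt" where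
  "plus_elt NegInf y = y"
| "plus_elt (Elt l a) NegInf = Elt l a"
| "plus_elt (Elt l a) (Elt m b) =
     (if a > b then Elt l a else if a < b then Elt m b else Elt (l + m) a)"

fun times_elt :: "'a elt \<Rightarrow> 'a elt \<Rightarrow> 'a elt" where
  "times_elt NegInf y = NegInf"
| "times_elt (Elt l a) NegInf = NegInf"
| "times_elt (Elt l a) (Elt m b) = Elt (l * m) (a + b)"

instance
proof
  fix x y z :: "'a elt"
  show "x + y + z = x + (y + z)"
    by (cases x; cases y; cases z) (auto simp: add.assoc)
  show "x + y = y + x"
    by (cases x; cases y) (auto simp: add.commute)
  show "0 + x = x"
    by (simp add: zero_elt_def)
  show "x * y * z = x * (y * z)"
    by (cases x; cases y; cases z) (auto simp: mult.assoc add.assoc)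
  show "x * y = y * x"
    by (cases x; cases y) (auto simp: mult.commute add.commute)
  show "1 * x = x"
    by (cases x) (auto simp: one_elt_def)
  show "(x + y) * z = x * z + y * z"
    by (cases x; cases y; cases z) (auto simp: distrib_right)
  show "0 * x = 0"
    by (simp add: zero_elt_def)
  show "x * 0 = 0"
    by (cases x) (auto simp: zero_elt_def)
  show "(0::'a elt) \<noteq> 1"
    by (simp add: zero_elt_def one_elt_def)
qed

end

primrec layer :: "'f::zero elt \<Rightarrow> 'f" where
  "layer NegInf = 0"
| "layer (Elt l a) = l"

definition layer_vec :: "('f::zero elt) ^ 'n \<Rightarrow> 'f ^ 'n" where
  "layer_vec v = (\<chi> k. layer (v $ k))"

definition elt_units :: "'f::zero elt set" where
  "elt_units = {Elt l a | l a. l \<noteq> 0}"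

text \<open>
  Dependence of the family \<open>(v i)\<close>, \<open>i \<in> I\<close>. It is a property of the family and not of its
  set of values, so a vector that is repeated counts once for each of its indices.
\<close>

definition elt_dependent :: "'i set \<Rightarrow> ('i \<Rightarrow> ('f::comm_semiring_1 elt) ^ 'n) \<Rightarrow> bool" where
  "elt_dependent I v \<longleftrightarrow>
     (\<exists>J a. J \<subseteq> I \<and> finite J \<and> J \<noteq> {} \<and> (\<forall>i\<in>J. a i \<in> elt_units) \<and>
        layer_vec (\<Sum>i\<in>J. a i *s v i) = 0)"

end

theory Submission
  imports Defs "HOL-Library.Poly_Mapping"
begin

text \<open>
  An element \<open>Elt l a\<close> of the ELT algebra behaves like the leading term \<open>l t\<^sup>a\<close> of a
  generalized polynomial, that is, of a finite sum of monomials \<open>c t\<^sup>b\<close> with real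
  exponents \<open>b\<close>. These generalized polynomials are the type \<open>real \<Rightarrow>\<^sub>0 'f\<close>, and because
  the exponents are linearly ordered they form an integral domain. Over an integral domain
  a homogeneous linear system with more unknowns than equations has a nonzero solution
  (\<open>more_unknowns_than_equations\<close>). The proof therefore lifts every entry \<open>Elt l a\<close> to the
  monomial \<open>l t\<^sup>a\<close>, solves the lifted system, and takes the leading terms of
  the nonzero unknowns as the coefficients of the dependence.

  What makes leading terms of the solution a dependence is the relation \<open>bounded_by f e\<close>:
  the exponents of \<open>f\<close> do not exceed the tangible value of \<open>e\<close>, and the coefficient of \<open>f\<close>
  at that value is the layer of \<open>e\<close>. The coefficient may be zero, which is the point: the
  relation, unlike the map that sends \<open>f\<close> to its leading term, survives the cancellation
  of leading terms, so that it is compatible with sums and products. It also lets an entry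
  of layer zero be lifted to the zero polynomial. Since each equation of the lifted system
  says that a sum is the polynomial \<open>0\<close>, the corresponding ELT sum bounds \<open>0\<close> and hence has
  layer zero.
\<close>

text \<open>
  Gaussian elimination without division. If the equation \<open>k\<close> has a nonzero
  coefficient, at the unknown \<open>p\<close> say, then \<open>p\<close> is eliminated from the other equations by
  cross-multiplication with that pivot. A solution of the smaller system, scaled by the
  pivot, extends to \<open>p\<close>, and it stays nonzero because there are no zero divisors.
\<close>

lemma more_unknowns_than_equations:
  fixes A :: "'i \<Rightarrow> 'k \<Rightarrow> 'r::idom"
  assumes "finite K" and "card K < card I"
  shows "\<exists>x. (\<exists>i\<in>I. x i \<noteq> 0) \<and> (\<forall>k\<in>K. (\<Sum>i\<in>I. x i * A i k) = 0)"
  using assms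
proof (induction K arbitrary: I A rule: finite_induct)
  case empty
  then have "I \<noteq> {}"
    by auto
  then show ?case
    by (intro exI[of _ "\<lambda>_. 1"]) auto
next
  case (insert k K)
  have fin: "finite I"
    using insert.prems card.infinite by fastforce
  show ?case
  proof (cases "\<forall>i\<in>I. A i k = 0")
    case True
    have "card K < card I"
      using insert by simp
    then obtain x where "\<exists>i\<in>I. x i \<noteq> 0" "\<forall>k\<in>K. (\<Sum>i\<in>I. x i * A i k) = 0"
      using insert.IH by blast
    with True show ?thesis
      by (intro exI[of _ x]) auto
  next
    case False
    then obtain p where p: "p \<in> I" "A p k \<noteq> 0"
      by blast
    let ?I = "I - {p}"
    define B where "B i k' = A p k * A i k' - A i k * A p k'" for i k'
    have "card K < card ?I"
      using insert p fin by simp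
    then obtain x where x: "\<exists>i\<in>?I. x i \<noteq> 0"
      and sol: "\<forall>k'\<in>K. (\<Sum>i\<in>?I. x i * B i k') = 0"
      using insert.IH by blast
    define y where "y i = (if i = p then - (\<Sum>j\<in>?I. x j * A j k) else A p k * x i)" for i
    have y_sum: "(\<Sum>i\<in>I. y i * A i k') = (\<Sum>i\<in>?I. x i * B i k')" for k'
    proof -
      have "(\<Sum>i\<in>I. y i * A i k') = y p * A p k' + (\<Sum>i\<in>?I. y i * A i k')"
        using p fin by (simp add: sum.remove)
      also have "\<dots> = (\<Sum>i\<in>?I. A p k * x i * A i k') - (\<Sum>i\<in>?I. x i * A i k) * A p k'"
        by (simp add: y_def)
      also have "\<dots> = (\<Sum>i\<in>?I. x i * B i k')"
        by (simp add: B_def sum_distrib_left sum_distrib_right sum_subtractf algebra_simps)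
      finally show ?thesis .
    qed
    have "\<forall>k'\<in>insert k K. (\<Sum>i\<in>I. y i * A i k') = 0"
      using sol by (auto simp: y_sum B_def)
    moreover have "\<exists>i\<in>I. y i \<noteq> 0"
      using x p by (auto simp: y_def)
    ultimately show ?thesis
      by blast
  qed
qed

lemma lookup_mult_group:
  fixes f g :: "'a::ab_group_add \<Rightarrow>\<^sub>0 'b::semiring_0"
  shows "Poly_Mapping.lookup (f * g) k =
    Sum_any (\<lambda>l. Poly_Mapping.lookup f l * Poly_Mapping.lookup g (k - l))"
proof -
  have "Sum_any (\<lambda>q. Poly_Mapping.lookup g q when k = l + q) = Poly_Mapping.lookup g (k - l)" for l
  proof -
    have "(\<lambda>q. Poly_Mapping.lookup g q when k = l + q) = (\<lambda>q. Poly_Mapping.lookup g q when q = k - l)"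
      by (rule ext) (auto simp: when_def algebra_simps)
    then show ?thesis
      by (simp only: Sum_any_when_equal)
  qed
  then show ?thesis
    by (simp add: lookup_mult)
qed

fun bounded_by :: "(real \<Rightarrow>\<^sub>0 'f) \<Rightarrow> 'f::zero elt \<Rightarrow> bool" where
  "bounded_by f NegInf \<longleftrightarrow> f = 0"
| "bounded_by f (Elt l a) \<longleftrightarrow> (\<forall>b>a. Poly_Mapping.lookup f b = 0) \<and> Poly_Mapping.lookup f a = l"

lemma bounded_by_add:
  fixes f g :: "real \<Rightarrow>\<^sub>0 'f::comm_semiring_1"
  assumes "bounded_by f d" and "bounded_by g e"
  shows "bounded_by (f + g) (d + e)"
  using assms by (cases d; cases e) (auto simp: lookup_add)

lemma bounded_by_mult:
  fixes f g :: "real \<Rightarrow>\<^sub>0 'f::comm_semiring_1"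
  assumes "bounded_by f d" and "bounded_by g e"
  shows "bounded_by (f * g) (d * e)"
proof (cases "d = NegInf \<or> e = NegInf")
  case True
  then show ?thesis
    using assms by (cases d; cases e) auto
next
  case False
  then obtain l a m b where de: "d = Elt l a" "e = Elt m b"
    by (metis elt.exhaust)
  have f: "Poly_Mapping.lookup f c = 0" if "c > a" for c
    using assms that de by simp
  have g: "Poly_Mapping.lookup g c = 0" if "c > b" for c
    using assms that de by simp
  have "Poly_Mapping.lookup (f * g) c = 0" if "c > a + b" for c
  proof -
    have "Poly_Mapping.lookup f r * Poly_Mapping.lookup g (c - r) = 0" for r
      using that by (cases "r > a") (auto simp: f g)
    then show ?thesis
      by (simp add: lookup_mult_group)
  qed
  moreover have "Poly_Mapping.lookup (f * g) (a + b) = l * m"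
  proof -
    \<comment> \<open>Exponents \<open>r\<close> and \<open>a + b - r\<close> that respect the bounds \<open>a\<close> and \<open>b\<close> must be equal to them.\<close>
    have "Poly_Mapping.lookup f r * Poly_Mapping.lookup g (a + b - r) =
        (Poly_Mapping.lookup f a * Poly_Mapping.lookup g b when r = a)" for r
      by (cases r a rule: linorder_cases) (auto simp: f g when_def)
    then show ?thesis
      using assms de by (simp add: lookup_mult_group)
  qed
  ultimately show ?thesis
    by (simp add: de)
qed

lemma bounded_by_sum:
  fixes f :: "'i \<Rightarrow> real \<Rightarrow>\<^sub>0 'f::comm_semiring_1"
  assumes "\<And>i. i \<in> J \<Longrightarrow> bounded_by (f i) (e i)"
  shows "bounded_by (\<Sum>i\<in>J. f i) (\<Sum>i\<in>J. e i)"
  using assms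
  by (induction J rule: infinite_finite_induct) (simp_all add: bounded_by_add zero_elt_def)

lemma layer_eq_0_if_bounds_0: "bounded_by 0 e \<Longrightarrow> layer e = 0"
  by (cases e) auto

primrec monomial :: "'f::zero elt \<Rightarrow> real \<Rightarrow>\<^sub>0 'f" where
  "monomial NegInf = 0"
| "monomial (Elt l a) = Poly_Mapping.single a l"

lemma bounded_by_monomial: "bounded_by (monomial e) e"
  by (cases e) (auto simp: lookup_single)

definition leading_term :: "(real \<Rightarrow>\<^sub>0 'f::zero) \<Rightarrow> 'f elt" where
  "leading_term f = Elt (Poly_Mapping.lookup f (Max (Poly_Mapping.keys f))) (Max (Poly_Mapping.keys f))"

lemma
  assumes "f \<noteq> 0"
  shows bounded_by_leading_term: "bounded_by f (leading_term f)"
    and leading_term_in_elt_units: "leading_term f \<in> elt_units"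
proof -
  have "Poly_Mapping.keys f \<noteq> {}"
    using assms by simp
  then have "Max (Poly_Mapping.keys f) \<in> Poly_Mapping.keys f"
    by simp
  then show "leading_term f \<in> elt_units"
    by (simp add: leading_term_def elt_units_def in_keys_iff)
  have "Poly_Mapping.lookup f b = 0" if "b > Max (Poly_Mapping.keys f)" for b
    using that by (meson Max_ge finite_keys in_keys_iff not_le)
  then show "bounded_by f (leading_term f)"
    by (simp add: leading_term_def)
qed

theorem corollary2p21:
  fixes v :: "'i \<Rightarrow> ('f::alg_closed_field elt) ^ 'n::finite" and I :: "'i set"
  assumes "card I = CARD('n) + 1"
  shows "elt_dependent I v"
proof -
  have "finite (UNIV :: 'n set)" and "card (UNIV :: 'n set) < card I"
    using assms by simp_all
  from more_unknowns_than_equations[OF this, of "\<lambda>i k. monomial (v i $ k)"]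
  obtain x where x: "\<exists>i\<in>I. x i \<noteq> 0"
    and sol: "\<And>k. (\<Sum>i\<in>I. x i * monomial (v i $ k)) = 0"
    by blast
  have fin: "finite I"
    using assms card.infinite by fastforce
  define J where "J = {i \<in> I. x i \<noteq> 0}"
  have "layer (\<Sum>i\<in>J. leading_term (x i) * v i $ k) = 0" for k
  proof -
    have "bounded_by (\<Sum>i\<in>J. x i * monomial (v i $ k)) (\<Sum>i\<in>J. leading_term (x i) * v i $ k)"
      by (intro bounded_by_sum bounded_by_mult bounded_by_leading_term bounded_by_monomial)
        (simp add: J_def)
    moreover have "(\<Sum>i\<in>J. x i * monomial (v i $ k)) = (\<Sum>i\<in>I. x i * monomial (v i $ k))"
      using fin by (intro sum.mono_neutral_left) (auto simp: J_def)
    ultimately show ?thesis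
      using sol[of k] by (simp add: layer_eq_0_if_bounds_0)
  qed
  then have "layer_vec (\<Sum>i\<in>J. leading_term (x i) *s v i) = 0"
    by (simp add: layer_vec_def vec_eq_iff)
  moreover have "J \<subseteq> I" "finite J" "J \<noteq> {}" "\<forall>i\<in>J. leading_term (x i) \<in> elt_units"
    using x fin by (auto simp: J_def leading_term_in_elt_units)
  ultimately show ?thesis
    unfolding elt_dependent_def by (intro exI[of _ J] exI[of _ "\<lambda>i. leading_term (x i)"]) simp
qed

end
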